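(* Let $E_1,\dots,E_s\in\mathbb{C}^{n\times n}$ and let $T(x)=\sum_{i=1}^{s}t_i(x)E_i$ and $R^*(x)=\sum_{i=1}^{s}r_i^*(x)E_i$ for $x\in\bar\Omega$. Write $\boldsymbol{\xi}^*(x)=[r_1^*(x),\dots,r_s^*(x)]^{\mathrm T}$ and $\boldsymbol{t}(x)=[t_1(x),\dots,t_s(x)]^{\mathrm T}$, and assume that $$\sup_{x\in\bar\Omega}\|\boldsymbol{t}(x)-\boldsymbol{\xi}^*(x)\|_2\le \epsilon .$$ Let $\mathscr{G}\in\mathbb{C}^{s\times s}$ be the matrix whose $(k,l)$ entry is $\mathrm{tr}(E_l^{\mathrm H}E_k)$. Then for any eigenpair $(\lambda,\boldsymbol{u})$ of $R^*$ with $\lambda\in\Omega$ and $\|\boldsymbol{u}\|_2=1$ (that is, $R^*(\lambda)\boldsymbol{u}=\boldsymbol{0}$), $$\|T(\lambda)\boldsymbol{u}\|_2\le\sqrt{\|\mathscr{G}\|_2}\;\epsilon .$$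
   Context: $\Omega\subset\mathbb{C}$ is a Jordan domain bounded by a simple Jordan curve $\Gamma=\partial\Omega$, and $\bar\Omega=\Omega\cup\Gamma$. Each $t_i:\bar\Omega\to\mathbb{C}$ is analytic in $\Omega$ and continuous on $\bar\Omega$. The functions $r_i^*(x)=p_i^*(x)/q^*(x)$, $i=1,\dots,s$, are rational functions with a common denominator polynomial $q^*\not\equiv 0$ and numerator polynomials $p_i^*$; the supremum hypothesis includes that they take finite values on $\bar\Omega$. $\|\cdot\|_2$ is the Euclidean norm of a vector or the spectral norm of a matrix, $\mathrm{tr}$ is the trace, and $E^{\mathrm H}$ is the conjugate transpose of $E$. *)

theory Defs
  imports
    "HOL-Analysis.Analysis"
    "HOL-Computational_Algebra.Computational_Algebra"
    "HOL-Computational_Algebra.Field_as_Ring"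
begin

definition jordan_domain :: "complex set \<Rightarrow> complex set \<Rightarrow> bool" where
  "jordan_domain \<Omega> \<Gamma> \<longleftrightarrow>
     open \<Omega> \<and> connected \<Omega> \<and> \<Omega> \<noteq> {} \<and> bounded \<Omega> \<and> frontier \<Omega> = \<Gamma> \<and>
     (\<exists>g. simple_path g \<and> pathfinish g = pathstart g \<and> path_image g = \<Gamma>)"

text \<open>
  The rational function \<open>p / q\<close> is an element of the field of fractions, so its values are
  taken in lowest terms: common zeros of \<open>p\<close> and \<open>q\<close> are removable, and the value at \<open>x\<close> is
  finite iff \<open>x\<close> is not a pole. Off the zeros of \<open>q\<close> this is the usual quotient, see
  \<open>ratfun_value_eq\<close>.
\<close>

definition ratfun_finite_at :: "complex poly \<Rightarrow> complex poly \<Rightarrow> complex \<Rightarrow> bool" where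
  "ratfun_finite_at p q x \<longleftrightarrow> poly (q div gcd p q) x \<noteq> 0"

definition ratfun_value :: "complex poly \<Rightarrow> complex poly \<Rightarrow> complex \<Rightarrow> complex" where
  "ratfun_value p q x = poly (p div gcd p q) x / poly (q div gcd p q) x"

lemma
  assumes "poly q x \<noteq> 0"
  shows ratfun_finite_at_nonzero: "ratfun_finite_at p q x"
    and ratfun_value_eq: "ratfun_value p q x = poly p x / poly q x"
proof -
  have q: "poly q x = poly (q div gcd p q) x * poly (gcd p q) x"
    by (metis dvd_div_mult_self gcd_dvd2 poly_mult)
  have p: "poly p x = poly (p div gcd p q) x * poly (gcd p q) x"
    by (metis dvd_div_mult_self gcd_dvd1 poly_mult)
  show "ratfun_finite_at p q x"
    using assms q by (auto simp: ratfun_finite_at_def)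
  show "ratfun_value p q x = poly p x / poly q x"
    using assms unfolding ratfun_value_def p q by auto
qed

definition cmat_scale :: "complex \<Rightarrow> complex^'n^'m \<Rightarrow> complex^'n^'m" where
  "cmat_scale c A = (\<chi> i j. c * A $ i $ j)"

definition conj_transpose :: "complex^'n^'m \<Rightarrow> complex^'m^'n" where
  "conj_transpose A = (\<chi> i j. cnj (A $ j $ i))"

text \<open>The norm on \<open>complex^'n\<close> is the Euclidean one, so its operator norm is the spectral norm.\<close>

definition spectral_norm :: "complex^'n^'m \<Rightarrow> real" where
  "spectral_norm A = onorm ((*v) A)"

definition gram_matrix :: "('s \<Rightarrow> complex^'n^'n) \<Rightarrow> complex^'s^'s" where
  "gram_matrix E = (\<chi> k l. trace (conj_transpose (E l) ** E k))"

definition eigenpair :: "(complex \<Rightarrow> complex^'n^'n) \<Rightarrow> complex \<Rightarrow> complex^'n \<Rightarrow> bool" where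
  "eigenpair F l u \<longleftrightarrow> u \<noteq> 0 \<and> F l *v u = 0"

end

theory Submission
  imports Defs
begin

text \<open>
  Fix an eigenpair \<open>(l, u)\<close>, put \<open>c = tvec l - \<xi> l\<close>, and let \<open>D\<close> be the linear combination of the
  \<open>E k\<close> with coefficients \<open>c\<close>. Since \<open>R l\<close> annihilates \<open>u\<close>, the residual \<open>T l *v u\<close> equals
  \<open>(T l - R l) *v u = D *v u\<close>, which for a unit vector \<open>u\<close> is at most the Frobenius norm of \<open>D\<close>
  (\<open>norm_matrix_vector_le\<close>). The matrix \<open>gram_matrix E\<close> collects the Frobenius inner products of
  the \<open>E k\<close>, so the squared Frobenius norm of \<open>D\<close> is the value at \<open>c\<close> of its Hermitian form
  (\<open>norm_lincomb_squared\<close>). Hence it is at most the spectral norm of \<open>gram_matrix E\<close> times the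
  square of \<open>norm c\<close> (\<open>norm_lincomb_le\<close>), and \<open>norm c\<close> is at most \<open>\<epsilon>\<close>.

  The norm of the nested vector type \<open>complex^'n^'m\<close> is the Frobenius norm, so \<open>norm D\<close> denotes it
  throughout.
\<close>

text \<open>
  Cauchy-Schwarz for the pairing without conjugation, which is the one that occurs in a
  matrix-vector product.
\<close>

lemma norm_sum_mult_le:
  fixes x y :: "complex^'n"
  shows "norm (\<Sum>i\<in>UNIV. x $ i * y $ i) \<le> norm x * norm y"
proof -
  have "norm (\<Sum>i\<in>UNIV. x $ i * y $ i) \<le> (\<Sum>i\<in>UNIV. norm (x $ i * y $ i))"
    by (rule norm_sum)
  also have "\<dots> = (\<Sum>i\<in>UNIV. \<bar>norm (x $ i)\<bar> * \<bar>norm (y $ i)\<bar>)"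
    by (simp add: norm_mult)
  also have "\<dots> \<le> norm x * norm y"
    unfolding norm_vec_def by (rule L2_set_mult_ineq)
  finally show ?thesis .
qed

text \<open>The Frobenius norm dominates the operator norm: apply Cauchy-Schwarz to each row.\<close>

lemma norm_matrix_vector_le:
  fixes A :: "complex^'n^'m"
  shows "norm (A *v x) \<le> norm A * norm x"
proof -
  have "norm (A *v x) \<le> L2_set (\<lambda>i. norm (A $ i) * norm x) UNIV"
    unfolding norm_vec_def[of "A *v x"]
    by (rule L2_set_mono) (simp_all add: matrix_vector_mult_def norm_sum_mult_le)
  also have "\<dots> = norm A * norm x"
    by (simp add: L2_set_left_distrib norm_vec_def[of A])
  finally show ?thesis .
qed

lemma bounded_linear_matrix_vector:
  fixes A :: "complex^'n^'m"
  shows "bounded_linear ((*v) A)"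
proof (rule bounded_linear_intro)
  show "A *v (x + y) = A *v x + A *v y" for x y
    by (rule matrix_vector_right_distrib)
  show "A *v (a *\<^sub>R x) = a *\<^sub>R (A *v x)" for a x
    by (simp add: vec_eq_iff matrix_vector_mult_def scaleR_sum_right)
  show "norm (A *v x) \<le> norm x * norm A" for x
    using norm_matrix_vector_le[of A x] by (simp add: mult.commute)
qed

lemma norm_matrix_vector_le_spectral_norm: "norm (A *v x) \<le> spectral_norm A * norm x"
  unfolding spectral_norm_def by (rule onorm[OF bounded_linear_matrix_vector])

lemma spectral_norm_nonneg: "0 \<le> spectral_norm A"
  unfolding spectral_norm_def by (rule onorm_pos_le[OF bounded_linear_matrix_vector])

lemma norm_matrix_squared:
  fixes A :: "complex^'n^'m"
  shows "complex_of_real ((norm A)\<^sup>2) = (\<Sum>i\<in>UNIV. \<Sum>j\<in>UNIV. A $ i $ j * cnj (A $ i $ j))"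
  by (simp add: norm_vec_def L2_set_def sum_nonneg flip: complex_norm_square)

lemma gram_matrix_entry:
  "gram_matrix E $ k $ l = (\<Sum>i\<in>UNIV. \<Sum>j\<in>UNIV. E k $ i $ j * cnj (E l $ i $ j))"
proof -
  have "gram_matrix E $ k $ l = (\<Sum>j\<in>UNIV. \<Sum>i\<in>UNIV. E k $ i $ j * cnj (E l $ i $ j))"
    by (simp add: gram_matrix_def trace_def matrix_matrix_mult_def conj_transpose_def mult.commute)
  also have "\<dots> = (\<Sum>i\<in>UNIV. \<Sum>j\<in>UNIV. E k $ i $ j * cnj (E l $ i $ j))"
    by (rule sum.swap)
  finally show ?thesis .
qed

lemma lincomb_entry:
  "(\<Sum>k\<in>UNIV. cmat_scale (c k) (E k)) $ i $ j = (\<Sum>k\<in>UNIV. c k * E k $ i $ j)"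
  by (simp add: cmat_scale_def)

text \<open>
  Expand the Frobenius inner product of the combination with itself. The second index of the Gram
  matrix belongs to the conjugated factor, so the conjugated coefficients are the ones to which
  the matrix is applied.
\<close>

lemma norm_lincomb_squared:
  fixes E :: "'s::finite \<Rightarrow> complex^'n^'n" and c :: "complex^'s"
  shows "complex_of_real ((norm (\<Sum>k\<in>UNIV. cmat_scale (c $ k) (E k)))\<^sup>2) =
    (\<Sum>k\<in>UNIV. c $ k * (gram_matrix E *v (\<chi> l. cnj (c $ l))) $ k)"
proof -
  let ?f = "\<lambda>k l i j. c $ k * E k $ i $ j * (cnj (c $ l) * cnj (E l $ i $ j))"
  have "complex_of_real ((norm (\<Sum>k\<in>UNIV. cmat_scale (c $ k) (E k)))\<^sup>2) =
      (\<Sum>i\<in>UNIV. \<Sum>j\<in>UNIV. \<Sum>k\<in>UNIV. \<Sum>l\<in>UNIV. ?f k l i j)"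
    unfolding norm_matrix_squared lincomb_entry by (simp add: sum_product)
  also have "\<dots> = (\<Sum>i\<in>UNIV. \<Sum>k\<in>UNIV. \<Sum>j\<in>UNIV. \<Sum>l\<in>UNIV. ?f k l i j)"
    by (rule sum.cong[OF refl], rule sum.swap)
  also have "\<dots> = (\<Sum>k\<in>UNIV. \<Sum>i\<in>UNIV. \<Sum>l\<in>UNIV. \<Sum>j\<in>UNIV. ?f k l i j)"
    by (subst sum.swap, intro sum.cong refl, rule sum.swap)
  also have "\<dots> = (\<Sum>k\<in>UNIV. \<Sum>l\<in>UNIV. \<Sum>i\<in>UNIV. \<Sum>j\<in>UNIV. ?f k l i j)"
    by (rule sum.cong[OF refl], rule sum.swap)
  also have "\<dots> = (\<Sum>k\<in>UNIV. c $ k * (gram_matrix E *v (\<chi> l. cnj (c $ l))) $ k)"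
    by (simp add: matrix_vector_mult_def gram_matrix_entry sum_distrib_left sum_distrib_right
        mult_ac)
  finally show ?thesis .
qed

text \<open>
  Cauchy-Schwarz bounds the form by \<open>norm c * norm (gram_matrix E *v d)\<close>, where the conjugate
  vector \<open>d\<close> of \<open>c\<close> has the same norm as \<open>c\<close>.
\<close>

lemma norm_lincomb_le:
  fixes E :: "'s::finite \<Rightarrow> complex^'n^'n" and c :: "complex^'s"
  shows "norm (\<Sum>k\<in>UNIV. cmat_scale (c $ k) (E k)) \<le>
    sqrt (spectral_norm (gram_matrix E)) * norm c"
proof -
  let ?D = "\<Sum>k\<in>UNIV. cmat_scale (c $ k) (E k)"
  let ?G = "gram_matrix E"
  let ?d = "\<chi> l. cnj (c $ l)"
  have "(norm ?D)\<^sup>2 = norm (complex_of_real ((norm ?D)\<^sup>2))"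
    by (simp only: norm_of_real abs_power2)
  also have "\<dots> \<le> norm c * norm (?G *v ?d)"
    unfolding norm_lincomb_squared by (rule norm_sum_mult_le)
  also have "\<dots> \<le> norm c * (spectral_norm ?G * norm ?d)"
    by (intro mult_left_mono norm_matrix_vector_le_spectral_norm norm_ge_zero)
  also have "norm ?d = norm c"
    by (simp add: norm_vec_def)
  finally have "(norm ?D)\<^sup>2 \<le> spectral_norm ?G * (norm c)\<^sup>2"
    by (simp add: power2_eq_square mult_ac)
  then have "norm ?D \<le> sqrt (spectral_norm ?G * (norm c)\<^sup>2)"
    by (rule real_le_rsqrt)
  then show ?thesis
    by (simp add: real_sqrt_mult)
qed

theorem corollary3p1:
  fixes \<Omega> \<Gamma> :: "complex set"
    and t r :: "'s::finite \<Rightarrow> complex \<Rightarrow> complex"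
    and p :: "'s \<Rightarrow> complex poly" and q :: "complex poly"
    and E :: "'s \<Rightarrow> complex^'n^'n"
    and T R :: "complex \<Rightarrow> complex^'n^'n"
    and \<xi> tvec :: "complex \<Rightarrow> complex^'s"
    and \<epsilon> :: real
  assumes "jordan_domain \<Omega> \<Gamma>"
    and "\<And>i. t i analytic_on \<Omega>"
    and "\<And>i. continuous_on (\<Omega> \<union> \<Gamma>) (t i)"
    and "q \<noteq> 0"
    and "\<And>i x. x \<in> \<Omega> \<union> \<Gamma> \<Longrightarrow> ratfun_finite_at (p i) q x"
    and "\<And>i x. x \<in> \<Omega> \<union> \<Gamma> \<Longrightarrow> r i x = ratfun_value (p i) q x"
    and "\<And>x. x \<in> \<Omega> \<union> \<Gamma> \<Longrightarrow> T x = (\<Sum>i\<in>UNIV. cmat_scale (t i x) (E i))"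
    and "\<And>x. x \<in> \<Omega> \<union> \<Gamma> \<Longrightarrow> R x = (\<Sum>i\<in>UNIV. cmat_scale (r i x) (E i))"
    and "\<And>x. x \<in> \<Omega> \<union> \<Gamma> \<Longrightarrow> \<xi> x = (\<chi> i. r i x)"
    and "\<And>x. x \<in> \<Omega> \<union> \<Gamma> \<Longrightarrow> tvec x = (\<chi> i. t i x)"
    and "(SUP x\<in>\<Omega> \<union> \<Gamma>. ereal (norm (tvec x - \<xi> x))) \<le> ereal \<epsilon>"
  shows "\<forall>l u. l \<in> \<Omega> \<longrightarrow> eigenpair R l u \<longrightarrow> norm u = 1 \<longrightarrow>
           norm (T l *v u) \<le> sqrt (spectral_norm (gram_matrix E)) * \<epsilon>"
proof (intro allI impI)
  fix l u
  assume l: "l \<in> \<Omega>" and eig: "eigenpair R l u" and u: "norm u = 1"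
  let ?G = "gram_matrix E"
  define c where "c = tvec l - \<xi> l"
  define D where "D = (\<Sum>i\<in>UNIV. cmat_scale (c $ i) (E i))"
  have lx: "l \<in> \<Omega> \<union> \<Gamma>" using l by simp
  have c: "c $ i = t i l - r i l" for i
    using assms(9,10)[OF lx] by (simp add: c_def)
  have "T l = R l + D"
    unfolding D_def c assms(7,8)[OF lx]
    by (simp add: vec_eq_iff cmat_scale_def left_diff_distrib sum_subtractf)
  then have "T l *v u = D *v u"
    using eig by (simp add: eigenpair_def matrix_vector_mult_add_rdistrib)
  then have "norm (T l *v u) \<le> norm D"
    using norm_matrix_vector_le[of D u] u by simp
  also have "\<dots> \<le> sqrt (spectral_norm ?G) * norm c"
    unfolding D_def by (rule norm_lincomb_le)
  also have "norm c \<le> \<epsilon>"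
  proof -
    have "ereal (norm c) \<le> (SUP x\<in>\<Omega> \<union> \<Gamma>. ereal (norm (tvec x - \<xi> x)))"
      unfolding c_def by (rule SUP_upper[OF lx])
    also note assms(11)
    finally show ?thesis by simp
  qed
  then have "sqrt (spectral_norm ?G) * norm c \<le> sqrt (spectral_norm ?G) * \<epsilon>"
    by (intro mult_left_mono) (simp_all add: spectral_norm_nonneg)
  finally show "norm (T l *v u) \<le> sqrt (spectral_norm ?G) * \<epsilon>" .
qed

end
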